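(* Let $n,r$ be integers with $2\le r\le n-1$ and put $s=n-r$. Let $U(n,r)$, $F=F_{n,r}$ and $I=I(n,r)$ be as defined in the context. Then every connected component of $U(n,r)$ is contained in the $\frac1{rn}$-neighbourhood $\{t:|t-\frac pr|\le\frac1{rn}\}$ of a single fraction $\frac pr$ with $p\in\mathbb Z$, $\gcd(p,r)=1$; the component contains $\frac pr$ when $2r>n-1$, and it does not contain $\frac pr$ (i.e. $U(n,r)$ is punctured at $\frac pr$) when $2r\le n-1$. The longest connected component of $U(n,r)$ has length \[ \ell(n,r)= \begin{cases} \dfrac{s}{r\,n}\ \displaystyle\max_{\substack{u \bmod r\\ \gcd(u,r)=1}} \Bigl(\dfrac1{F(u)}+\dfrac1{F(r-u)}\Bigr), & \text{if } 2r>n-1,\\[3ex] \dfrac{2s-I}{2\,r\,n\,I}, & \text{if } 2r\le n-1 \text{ (and } 2s>I). \end{cases} \] Moreover, if $2r>n-1$, then $\sup_{t\in U(n,r)}\lVert rt\rVert=\dfrac{s}{n\,I}$.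
   Context: $\lVert x\rVert$ denotes the distance from the real number $x$ to the nearest integer, and $[n-1]=\{1,\dots,n-1\}$. For integers $2\le r\le n-1$, \[ U(n,r)=\Bigl\{t\in[0,1):\ \lVert it\rVert>\tfrac1n\ \text{ for all } i\in[n-1]\setminus\{r\}\Bigr\}. \] For an integer $x$, $F(x)=F_{n,r}(x)=\max\{i\in[n-1]:\ i\ne r,\ i\equiv x \pmod r\}$ (depending only on $x$ modulo $r$), and \[ I(n,r)=\min_{\substack{u \bmod r\\ \gcd(u,r)=1}}\ \min\bigl(F(u),\,F(r-u)\bigr). \] *)

theory Defs
  imports "HOL-Analysis.Analysis" "HOL-Number_Theory.Cong"
begin

definition dist_int :: "real \<Rightarrow> real" where
  "dist_int x = \<bar>x - of_int (round x)\<bar>"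

definition U_set :: "nat \<Rightarrow> nat \<Rightarrow> real set" where
  "U_set n r = {t \<in> {0..<1}. \<forall>i \<in> {1..n-1} - {r}. dist_int (real i * t) > 1 / real n}"

text \<open>Only used at arguments coprime to \<open>r\<close>, where the set is nonempty for \<open>2 \<le> r \<le> n - 1\<close>.\<close>

definition F_max :: "nat \<Rightarrow> nat \<Rightarrow> int \<Rightarrow> nat" where
  "F_max n r x = Max {i \<in> {1..n-1}. i \<noteq> r \<and> [int i = x] (mod int r)}"

lemma F_max_mod: "F_max n r (x mod int r) = F_max n r x"
  by (simp add: F_max_def cong_def)

text \<open>Representatives of the residues \<open>u\<close> modulo \<open>r\<close> that are coprime to \<open>r\<close>; by
  \<open>F_max_mod\<close> the quantities below do not depend on the choice of representatives.\<close>

definition coprime_residues :: "nat \<Rightarrow> int set" where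
  "coprime_residues r = {u \<in> {0..<int r}. coprime u (int r)}"

definition I_min :: "nat \<Rightarrow> nat \<Rightarrow> nat" where
  "I_min n r = Min ((\<lambda>u. min (F_max n r u) (F_max n r (int r - u))) ` coprime_residues r)"

text \<open>\<open>L\<close> is the length of a longest connected component of \<open>S\<close>: the maximum is attained.
  Components of a set of reals are intervals, so their length is their Lebesgue measure.\<close>

definition longest_component_length :: "real set \<Rightarrow> real \<Rightarrow> bool" where
  "longest_component_length S L \<longleftrightarrow>
     (\<exists>C \<in> components S. measure lborel C = L \<and>
        (\<forall>C' \<in> components S. measure lborel C' \<le> L))"

end

theory Submission imports Defs begin

text \<open>By Dirichlet's theorem some \<open>i \<in> {1..n-1}\<close> satisfies \<open>dist_int (i t) \<le> 1 / n\<close>; for \<open>t\<close> in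
  \<open>U_set n r\<close> it can only be \<open>i = r\<close>, so \<open>t = p / r + y / (r n)\<close> with \<open>\<bar>y\<bar> \<le> 1\<close>, and a common factor \<open>d\<close>
  of \<open>p\<close> and \<open>r\<close> would make \<open>i = r / d\<close> violate the defining condition. In the coordinate \<open>y\<close> the
  condition says \<open>\<bar>n b + i y\<bar> > r\<close> for all \<open>i \<noteq> r\<close> and all \<open>b \<equiv> i p (mod r)\<close>, which only bites for
  \<open>b \<in> {-1, 0, 1}\<close>. With \<open>u\<close> the inverse of \<open>p\<close> modulo \<open>r\<close>, \<open>b = 1\<close> means \<open>i \<equiv> u\<close> and gives
  \<open>y > - s / F u\<close>, \<open>b = -1\<close> means \<open>i \<equiv> - u\<close> and gives \<open>y < s / F (r - u)\<close>, and \<open>b = 0\<close> means that \<open>i\<close>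
  is a multiple of \<open>r\<close>, where \<open>i = 2 r\<close> (if admissible) gives \<open>\<bar>y\<bar> > 1 / 2\<close>.\<close>

section \<open>Distance to the nearest integer and Dirichlet approximation\<close>

lemma dist_int_le: "dist_int x \<le> \<bar>x - of_int m\<bar>"
  unfolding dist_int_def by (rule round_diff_minimal)

lemma less_dist_int_iff: "c < dist_int x \<longleftrightarrow> (\<forall>m::int. c < \<bar>x - of_int m\<bar>)"
  using dist_int_le[of x] unfolding dist_int_def by (meson less_le_trans)

lemma dist_int_of_int_add:
  assumes "\<bar>x\<bar> \<le> 1/2"
  shows "dist_int (of_int m + x) = \<bar>x\<bar>"
proof (rule antisym)
  show "dist_int (of_int m + x) \<le> \<bar>x\<bar>"
    using dist_int_le[of "of_int m + x" m] by simp
  \<comment> \<open>\<open>k\<close> is the offset of the chosen rounding from \<open>m\<close>. It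
    may be nonzero in the tie |x| = 1/2, but an integer other than \<open>m\<close> is at distance
    at least 1 - |x| \<ge> |x|.\<close>
  define k where "k = round (of_int m + x) - m"
  have "\<bar>x\<bar> \<le> \<bar>x - of_int k\<bar>"
  proof (cases "k = 0")
    case False
    then have "1 \<le> \<bar>real_of_int k\<bar>" by linarith
    then show ?thesis using assms by linarith
  qed simp
  then show "\<bar>x\<bar> \<le> dist_int (of_int m + x)"
    unfolding dist_int_def k_def by (simp add: algebra_simps)
qed

text \<open>Unlike \<open>Dirichlet_approx\<close>, the denominator is at most \<open>n - 1\<close> here, at the price of a non-strict
  bound: either two of the fractional parts of the first \<open>n\<close> multiples share a box of length
  \<open>1/n\<close>, or every box is occupied, in particular the last one.\<close>
lemma Dirichlet_approx_weak:
  fixes t :: real and n :: nat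
  assumes "2 \<le> n"
  obtains k :: nat and h :: int where "0 < k" "k < n" "\<bar>real k * t - of_int h\<bar> \<le> 1 / real n"
proof -
  define box where "box k = nat \<lfloor>frac (real k * t) * real n\<rfloor>" for k :: nat
  have n0: "real n > 0" using assms by simp
  have lo: "real (box k) \<le> frac (real k * t) * real n"
    and hi: "frac (real k * t) * real n < real (box k) + 1" for k
  proof -
    have "0 \<le> frac (real k * t) * real n" by simp
    then show "real (box k) \<le> frac (real k * t) * real n"
      and "frac (real k * t) * real n < real (box k) + 1"
      unfolding box_def by linarith+
  qed
  have range: "box ` {..<n} \<subseteq> {..<n}"
  proof clarsimp
    fix k
    have "frac (real k * t) * real n < 1 * real n"
      using n0 by (intro mult_strict_right_mono frac_lt_1)
    then show "box k < n" using lo[of k] by linarith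
  qed
  show ?thesis
  proof (cases "inj_on box {..<n}")
    case True
    then have "box ` {..<n} = {..<n}"
      using range by (simp add: endo_inj_surj)
    then have "n - 1 \<in> box ` {..<n}" using assms by simp
    then obtain k where k: "k < n" "box k = n - 1" by auto
    have "k \<noteq> 0"
    proof
      assume "k = 0"
      then have "box k = 0" by (simp add: box_def)
      then show False using k assms by simp
    qed
    have "real n - 1 \<le> frac (real k * t) * real n"
      using lo[of k] k assms by (simp add: of_nat_diff)
    then have "1 - 1 / real n \<le> frac (real k * t)"
      using n0 by (simp add: field_simps)
    moreover have "frac (real k * t) < 1" by (rule frac_lt_1)
    ultimately have "\<bar>real k * t - of_int (\<lfloor>real k * t\<rfloor> + 1)\<bar> \<le> 1 / real n"
      unfolding frac_def by (simp add: abs_le_iff)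
    then show ?thesis using that \<open>k \<noteq> 0\<close> k by blast
  next
    case False
    then obtain a b where ab: "a < b" "b < n" "box a = box b"
      unfolding inj_on_def by (metis lessThan_iff linorder_neqE_nat)
    have "\<bar>frac (real b * t) * real n - frac (real a * t) * real n\<bar> \<le> 1"
      using lo[of a] hi[of a] lo[of b] hi[of b] ab(3) by linarith
    then have "\<bar>(frac (real b * t) - frac (real a * t)) * real n\<bar> \<le> 1"
      by (simp add: algebra_simps)
    then have "\<bar>frac (real b * t) - frac (real a * t)\<bar> \<le> 1 / real n"
      using n0 by (simp only: abs_mult abs_of_nat pos_le_divide_eq)
    moreover have "frac (real b * t) - frac (real a * t) =
        real (b - a) * t - of_int (\<lfloor>real b * t\<rfloor> - \<lfloor>real a * t\<rfloor>)"
      using ab by (simp add: frac_def of_nat_diff algebra_simps)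
    ultimately show ?thesis using that[of "b - a"] ab by (metis diff_le_self le_less_trans zero_less_diff)
  qed
qed

section \<open>Components of sets of reals\<close>

text \<open>A connected set of reals that reaches from inside the interval to outside it must pass
  through \<open>a\<close> or \<open>b\<close>, and neither lies in \<open>S\<close>.\<close>

lemma greaterThanLessThan_in_components:
  fixes S :: "real set"
  assumes "a < b" "{a<..<b} \<subseteq> S" "a \<notin> S" "b \<notin> S"
  shows "{a<..<b} \<in> components S"
  unfolding in_components_maximal
proof (intro conjI allI impI)
  show "{a<..<b} \<noteq> {}" "{a<..<b} \<subseteq> S" "connected {a<..<b}"
    using assms by auto
  fix D assume D: "D \<noteq> {} \<and> {a<..<b} \<subseteq> D \<and> D \<subseteq> S \<and> connected D"
  obtain c where c: "a < c" "c < b" using assms(1) dense by blast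
  have "c \<in> D" using D c by auto
  have "y \<in> {a<..<b}" if "y \<in> D" for y
  proof (rule ccontr)
    assume "y \<notin> {a<..<b}"
    then have "a \<in> {y..c} \<or> b \<in> {c..y}" using c by auto
    then have "a \<in> D \<or> b \<in> D"
      using connected_contains_Icc[of D] D \<open>c \<in> D\<close> \<open>y \<in> D\<close> by blast
    then show False using D assms by blast
  qed
  then show "D = {a<..<b}" using D by blast
qed

text \<open>Components are nonempty and pairwise disjoint, so a family of them that covers
  \<open>S\<close> cannot miss one.\<close>

lemma components_eqI:
  assumes "\<C> \<subseteq> components S" "S \<subseteq> \<Union>\<C>"
  shows "components S = \<C>"
proof (rule antisym)
  show "components S \<subseteq> \<C>"
  proof
    fix C assume C: "C \<in> components S"
    then obtain x where "x \<in> C" "x \<in> S"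
      using in_components_nonempty in_components_subset by blast
    then obtain D where "D \<in> \<C>" "x \<in> D" using assms(2) by blast
    then have "C = D" using components_eq[OF C] assms(1) \<open>x \<in> C\<close> by blast
    then show "C \<in> \<C>" using \<open>D \<in> \<C>\<close> by simp
  qed
qed (rule assms)

section \<open>Residues coprime to r and the function F\<close>

locale punctured_distance =
  fixes n r s :: nat
  assumes r_ge2: "2 \<le> r" and r_le: "r \<le> n - 1" and s_eq: "s = n - r"
begin

abbreviation F :: "int \<Rightarrow> nat" where "F \<equiv> F_max n r"
abbreviation R :: "int set" where "R \<equiv> coprime_residues r"

text \<open>In the coordinate \<open>y\<close> around \<open>p / r\<close> the neighbourhood of radius \<open>1 / (r n)\<close> is \<open>{-1..1}\<close>.\<close>
definition near :: "int \<Rightarrow> real \<Rightarrow> real" where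
  "near p y = of_int p / real r + y / (real r * real n)"

text \<open>A component sits at \<open>p / r\<close>, but its endpoints depend on the inverse
  \<open>u\<close>. The symmetric relation lets components be listed by \<open>p\<close> and extrema
  be taken over \<open>u\<close>.\<close>

definition inverse_pair :: "int \<Rightarrow> int \<Rightarrow> bool" where
  "inverse_pair p u \<longleftrightarrow> p \<in> R \<and> u \<in> R \<and> [p * u = 1] (mod int r)"

lemma r_pos: "0 < r" and n_ge3: "3 \<le> n" and r_less_n: "r < n" and s_pos: "0 < s"
  using r_ge2 r_le s_eq by auto

lemma coprime_residue_bounds:
  assumes "u \<in> R"
  shows "0 < u" "u < int r"
proof -
  have "u \<noteq> 0" using assms r_ge2 by (auto simp: coprime_residues_def)
  then show "0 < u" "u < int r" using assms by (auto simp: coprime_residues_def)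
qed

lemma coprime_residue_minus: "u \<in> R \<Longrightarrow> int r - u \<in> R"
  using coprime_residue_bounds[of u]
  by (simp add: coprime_residues_def coprime_iff_gcd_eq_1 gcd_diff2)

lemma finite_coprime_residues: "finite R" and coprime_residues_nonempty: "R \<noteq> {}"
proof -
  show "finite R"
    by (rule finite_subset[of _ "{0..<int r}"]) (auto simp: coprime_residues_def)
  have "1 \<in> R" using r_ge2 by (simp add: coprime_residues_def)
  then show "R \<noteq> {}" by blast
qed

lemma inverse_pair_ex:
  assumes "u \<in> R"
  obtains p where "inverse_pair p u" "inverse_pair u p"
proof -
  have "coprime u (int r)" using assms by (simp add: coprime_residues_def)
  then obtain x where x: "[u * x = 1] (mod int r)"
    using cong_solve_coprime_int by blast
  define p where "p = x mod int r"
  have up: "[u * p = 1] (mod int r)"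
    using x unfolding p_def cong_def by (simp add: mod_mult_right_eq)
  then have "coprime (u * p) (int r)"
    by (metis cong_imp_coprime cong_sym coprime_1_left)
  then have "p \<in> R"
    using r_pos by (simp add: coprime_residues_def p_def)
  then show thesis
    using that assms up by (metis inverse_pair_def mult.commute)
qed

text \<open>The \<open>r\<close> consecutive integers \<open>s\<close>, ..., \<open>n - 1\<close>
  meet every residue class modulo \<open>r\<close>, whence \<open>F u\<close> is at least
  \<open>s\<close>.\<close>

lemma F_props:
  assumes "u \<in> R"
  shows F_ge_s: "s \<le> F u" and F_less: "F u < n" and F_neq: "F u \<noteq> r"
    and F_cong: "[int (F u) = u] (mod int r)"
    and F_greatest: "\<And>i. \<lbrakk>0 < i; i < n; [int i = u] (mod int r)\<rbrakk> \<Longrightarrow> i \<le> F u"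
proof -
  let ?A = "{i \<in> {1..n-1}. i \<noteq> r \<and> [int i = u] (mod int r)}"
  have neq: "i \<noteq> r" if "[int i = u] (mod int r)" for i
  proof
    assume "i = r"
    then have "[u = 0] (mod int r)" using that by (simp add: cong_def)
    then show False
      using coprime_residue_bounds[OF assms] by (simp add: cong_def)
  qed
  have fin: "finite ?A" by simp
  have le: "i \<le> F u" if "0 < i" "i < n" "[int i = u] (mod int r)" for i
    unfolding F_max_def using that neq by (intro Max_ge[OF fin]) auto
  \<comment> \<open>The representative of \<open>u\<close> among \<open>s\<close>, ...,
    \<open>s + r - 1 = n - 1\<close>.\<close>
  define j where "j = s + nat ((u - int s) mod int r)"
  have m: "0 \<le> (u - int s) mod int r" "(u - int s) mod int r < int r"
    using r_pos by auto
  have j: "0 < j" "j < n" "s \<le> j" "[int j = u] (mod int r)"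
  proof -
    show "0 < j" "s \<le> j" using s_pos by (auto simp: j_def)
    show "j < n" using m r_less_n unfolding j_def s_eq by linarith
    have "int j = int s + (u - int s) mod int r" using m by (simp add: j_def)
    then show "[int j = u] (mod int r)" by (simp add: cong_def mod_add_right_eq)
  qed
  then have "?A \<noteq> {}" using neq by (auto intro!: exI[of _ j])
  then have "F u \<in> ?A" unfolding F_max_def using fin by (intro Max_in) auto
  then show "F u < n" "F u \<noteq> r" "[int (F u) = u] (mod int r)" using n_ge3 by auto
  show "s \<le> F u" using le j by (meson order_trans)
  show "\<And>i. \<lbrakk>0 < i; i < n; [int i = u] (mod int r)\<rbrakk> \<Longrightarrow> i \<le> F u" by (rule le)
qed

lemma F_pos: "u \<in> R \<Longrightarrow> 0 < F u"
  using F_ge_s[of u] s_pos by linarith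

text \<open>Keeps the endpoints \<open>- s / F u\<close> and \<open>s / F (r - u)\<close> inside the
  coordinate range \<open>{-1..1}\<close>, where membership in \<open>U_set n r\<close> is
  characterised below.\<close>

lemma s_div_F: "u \<in> R \<Longrightarrow> 0 < real s / real (F u) \<and> real s / real (F u) \<le> 1"
  using F_ge_s[of u] F_pos[of u] s_pos by simp

text \<open>Since \<open>F u \<le> n - 1 = s + r - 1\<close>, and \<open>r \<le> s\<close> in this case.\<close>
lemma half_less_s_div_F:
  assumes "2 * r \<le> n - 1" "u \<in> R"
  shows "1/2 < real s / real (F u)"
proof -
  have "F u < 2 * s" using F_less[OF assms(2)] assms(1) s_eq by linarith
  then have "real (F u) < 2 * real s" by linarith
  then show ?thesis using F_pos[OF assms(2)] by (simp add: field_simps)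
qed

section \<open>The set U in local coordinates\<close>

lemma mem_U_iff:
  "t \<in> U_set n r \<longleftrightarrow> 0 \<le> t \<and> t < 1 \<and>
    (\<forall>i m. 0 < i \<and> i < n \<and> i \<noteq> r \<longrightarrow> 1 / real n < \<bar>real i * t - of_int m\<bar>)"
  using n_ge3 by (auto simp: U_set_def less_dist_int_iff)

text \<open>Necessity tests only the indices \<open>F u\<close>, \<open>F (r - u)\<close> and
  \<open>2 r\<close>. They suffice: \<open>s / i\<close> decreases in \<open>i\<close>, so the
  largest index of a class gives the strongest bound for \<open>b = 1\<close> and
  \<open>b = -1\<close>, while for \<open>b = 0\<close> the bound \<open>r / i\<close> on |y| is
  strongest at the smallest multiple.\<close>

lemma near_mem_U_iff:
  assumes pu: "inverse_pair p u" and y: "\<bar>y\<bar> \<le> 1"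
  shows "near p y \<in> U_set n r \<longleftrightarrow>
    - (real s / real (F u)) < y \<and> y < real s / real (F (int r - u)) \<and>
    (2 * r \<le> n - 1 \<longrightarrow> 1/2 < \<bar>y\<bar>)"
proof -
  have p: "p \<in> R" and u: "u \<in> R" and inv: "[p * u = 1] (mod int r)"
    using pu by (auto simp: inverse_pair_def)
  have u': "int r - u \<in> R" using u by (rule coprime_residue_minus)
  have n0: "real n > 0" and r0: "real r > 0" using n_ge3 r_pos by auto
  have snr: "real s = real n - real r" using r_less_n by (simp add: s_eq of_nat_diff)
  \<comment> \<open>After scaling by \<open>r\<close>, the point is \<open>p + y / n\<close> with 1
    \<le> \<open>p\<close> \<le> \<open>r - 1\<close> and |y / n| < 1, so it cannot leave the unit
    interval.\<close>
  have "0 \<le> near p y \<and> near p y < 1"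
  proof -
    have p': "1 \<le> real_of_int p" "real_of_int p \<le> real r - 1"
      using coprime_residue_bounds[OF p] by linarith+
    have "1 / real n \<le> 1" "\<bar>y / real n\<bar> \<le> 1 / real n"
      using n_ge3 y by (auto simp: divide_right_mono abs_divide)
    then have "\<bar>y / real n\<bar> < 1" using n_ge3 y by (simp add: abs_divide)
    moreover have "real r * near p y = of_int p + y / real n"
      using r0 by (simp add: near_def field_simps)
    ultimately have "0 < real r * near p y" "real r * near p y < real r * 1"
      using p' by linarith+
    then show ?thesis using r0 by (simp add: zero_less_mult_iff)
  qed
  moreover have "1 / real n < \<bar>real i * near p y - of_int m\<bar> \<longleftrightarrow>
      real r < \<bar>real n * of_int (int i * p - m * int r) + real i * y\<bar>" for i :: nat and m :: int
  proof -
    have "real i * near p y - of_int m =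
        (real n * of_int (int i * p - m * int r) + real i * y) / (real r * real n)"
      using n0 r0 by (simp add: near_def field_simps)
    then have "\<bar>real i * near p y - of_int m\<bar> =
        \<bar>real n * of_int (int i * p - m * int r) + real i * y\<bar> / (real r * real n)"
      by (simp add: abs_divide abs_mult)
    moreover have "1 / real n = real r / (real r * real n)" using r0 by simp
    moreover have "0 < real r * real n" using n0 r0 by simp
    ultimately show ?thesis by (metis divide_less_cancel order_less_asym)
  qed
  ultimately have mem: "near p y \<in> U_set n r \<longleftrightarrow>
      (\<forall>i m. 0 < i \<and> i < n \<and> i \<noteq> r \<longrightarrow>
         real r < \<bar>real n * of_int (int i * p - m * int r) + real i * y\<bar>)"
    unfolding mem_U_iff by simp
  \<comment> \<open>As |i y| < n, the sign of \<open>n b + i y\<close> is that of \<open>b\<close>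
    whenever \<open>b\<close> is nonzero, which resolves the absolute values below.\<close>
  have iy: "\<bar>real i * y\<bar> \<le> real n - 1" if "i < n" for i
  proof -
    have "\<bar>real i * y\<bar> \<le> real i * 1"
      unfolding abs_mult using y by (intro mult_mono) auto
    then show ?thesis using that by linarith
  qed
  have lower: "real r < real n + real i * y \<longleftrightarrow> - (real s / real i) < y"
    and upper: "real r < real n - real i * y \<longleftrightarrow> y < real s / real i" if "0 < i" for i
    using that by (auto simp: snr field_simps)
  show ?thesis
  proof (intro iffI conjI impI)
    assume "near p y \<in> U_set n r"
    then have *: "real r < \<bar>real n * of_int (int i * p - m * int r) + real i * y\<bar>"
      if "0 < i" "i < n" "i \<noteq> r" for i m
      using that mem by blast
    \<comment> \<open>The index \<open>F u\<close> lies in the class of the inverse of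
      \<open>p\<close>, so a suitable \<open>m\<close> realises \<open>b = 1\<close>.\<close>
    have "[int (F u) * p = 1] (mod int r)"
      using F_cong[OF u] inv by (metis cong_scalar_right cong_trans mult.commute)
    then have "int r dvd int (F u) * p - 1" by (simp add: cong_iff_dvd_diff)
    then obtain m where "int (F u) * p - 1 = int r * m" by (rule dvdE)
    then have m: "int (F u) * p - m * int r = 1" by (simp add: algebra_simps)
    have "real r < \<bar>real n * of_int 1 + real (F u) * y\<bar>"
      using *[of "F u" m] m F_pos[OF u] F_less[OF u] F_neq[OF u] by simp
    then have "real r < real n + real (F u) * y"
      using iy[OF F_less[OF u]] by simp
    then show "- (real s / real (F u)) < y" using lower F_pos[OF u] by blast
    \<comment> \<open>Likewise \<open>F (r - u)\<close> lies in the class of \<open>- u\<close> and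
      realises \<open>b = -1\<close>.\<close>
    have "[int (F (int r - u)) * p = (int r - u) * p] (mod int r)"
      using F_cong[OF u'] by (rule cong_scalar_right)
    moreover have "[(int r - u) * p = - 1] (mod int r)"
    proof -
      have "(int r - u) * p - (- 1) = int r * p - (p * u - 1)" by (simp add: algebra_simps)
      then show ?thesis using inv unfolding cong_iff_dvd_diff by (metis dvd_diff dvd_triv_left)
    qed
    ultimately have "[int (F (int r - u)) * p = - 1] (mod int r)" by (rule cong_trans)
    then have "int r dvd int (F (int r - u)) * p + 1" by (simp add: cong_iff_dvd_diff)
    then obtain m' where m': "int (F (int r - u)) * p + 1 = int r * m'" by (rule dvdE)
    then have "int (F (int r - u)) * p - m' * int r = - 1" by (simp add: algebra_simps)
    then have "real r < \<bar>real n * of_int (- 1) + real (F (int r - u)) * y\<bar>"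
      using *[of "F (int r - u)" m'] F_pos[OF u'] F_less[OF u'] F_neq[OF u'] by simp
    then have "real r < real n - real (F (int r - u)) * y"
      using iy[OF F_less[OF u']] by simp
    then show "y < real s / real (F (int r - u))" using upper F_pos[OF u'] by blast
    assume "2 * r \<le> n - 1"
    \<comment> \<open>The index \<open>2 r\<close> with \<open>m = 2 p\<close> realises
      \<open>b = 0\<close>.\<close>
    then have "real r < \<bar>real (2 * r) * y\<bar>"
      using *[of "2 * r" "2 * p"] r_ge2 n_ge3 by simp
    then show "1/2 < \<bar>y\<bar>" using r0 by (simp add: abs_mult)
  next
    assume A: "- (real s / real (F u)) < y \<and> y < real s / real (F (int r - u)) \<and>
      (2 * r \<le> n - 1 \<longrightarrow> 1/2 < \<bar>y\<bar>)"
    show "near p y \<in> U_set n r"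
      unfolding mem
    proof (intro allI impI)
      fix i m assume i: "0 < i \<and> i < n \<and> i \<noteq> r"
      define b where "b = int i * p - m * int r"
      have ib: "[int i * p = b] (mod int r)"
        by (simp add: b_def cong_iff_dvd_diff)
      \<comment> \<open>Multiplying by the inverse \<open>u\<close> recovers the class of
        \<open>i\<close> from \<open>b\<close>.\<close>
      have iub: "[int i = b * u] (mod int r)"
      proof -
        have "[int i * p * u = b * u] (mod int r)" using ib by (rule cong_scalar_right)
        moreover have "[int i * (p * u) = int i * 1] (mod int r)"
          using inv by (rule cong_scalar_left)
        ultimately show ?thesis unfolding mult.assoc mult_1_right by (meson cong_sym cong_trans)
      qed
      have iyn: "\<bar>real i * y\<bar> \<le> real n - 1" using iy i by blast
      consider "b = 0" | "b = 1" | "b = -1" | "2 \<le> \<bar>b\<bar>" by linarith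
      then have "real r < \<bar>real n * of_int b + real i * y\<bar>"
      proof cases
        case 1
        then have "r dvd i" using iub by (simp add: cong_iff_dvd_diff)
        then obtain k where k: "i = r * k" by (rule dvdE)
        have "k \<noteq> 0" "k \<noteq> 1" using k i by (auto intro!: Nat.gr0I)
        \<comment> \<open>An admissible multiple of \<open>r\<close> other than \<open>r\<close>
          forces \<open>2 r\<close> below \<open>n\<close>, which activates the hypothesis |y| >
          1/2.\<close>
        then have "2 * r \<le> i" using k by simp
        then have "real (2 * r) * \<bar>y\<bar> \<le> real i * \<bar>y\<bar>" and "1/2 < \<bar>y\<bar>"
          using i A by (auto intro!: mult_right_mono)
        moreover have "real r < real (2 * r) * \<bar>y\<bar>" using \<open>1/2 < \<bar>y\<bar>\<close> r0 by simp
        ultimately show ?thesis using 1 by (simp add: abs_mult)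
      next
        case 2
        then have le: "i \<le> F u" using F_greatest[OF u] i iub by simp
        have "real s / real (F u) \<le> real s / real i"
          using le i by (intro divide_left_mono) auto
        then have "real r < real n + real i * y" using lower[of i] A i by linarith
        then show ?thesis using 2 by simp
      next
        case 3
        have "int i - (int r - u) = (int i - b * u) - int r" using 3 by simp
        then have "[int i = int r - u] (mod int r)"
          using iub unfolding cong_iff_dvd_diff by (metis dvd_diff dvd_refl)
        then have le: "i \<le> F (int r - u)" using F_greatest[OF u'] i by simp
        have "real s / real (F (int r - u)) \<le> real s / real i"
          using le i by (intro divide_left_mono) auto
        then have "real r < real n - real i * y" using upper[of i] A i by linarith
        then show ?thesis using 3 by simp
      next
        case 4
        \<comment> \<open>Here |n b + i y| is at least 2 n - (n - 1) > r, with no constraint on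
          \<open>y\<close> beyond |y| \<le> 1.\<close>
        have "real n * 2 \<le> real n * \<bar>of_int b\<bar>"
          using 4 by (intro mult_left_mono) auto
        then have "real n * 2 \<le> \<bar>real n * of_int b\<bar>" by (simp add: abs_mult)
        moreover have "real r \<le> real n - 1" using r_less_n by linarith
        ultimately show ?thesis using iyn by linarith
      qed
      then show "real r < \<bar>real n * of_int (int i * p - m * int r) + real i * y\<bar>"
        by (simp add: b_def)
    qed
  qed
qed

lemma mem_U_imp_near:
  assumes t: "t \<in> U_set n r"
  obtains p u y where "inverse_pair p u" "\<bar>y\<bar> \<le> 1" "t = near p y"
proof -
  have n0: "real n > 0" and r0: "real r > 0" using n_ge3 r_pos by auto
  have t01: "0 \<le> t" "t < 1" using t by (auto simp: mem_U_iff)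
  have far: "1 / real n < \<bar>real i * t - of_int m\<bar>" if "0 < i" "i < n" "i \<noteq> r" for i m
    using t that by (auto simp: mem_U_iff)
  obtain k h where k: "0 < k" "k < n" and "\<bar>real k * t - of_int h\<bar> \<le> 1 / real n"
    using Dirichlet_approx_weak[of n t] n_ge3 by auto
  \<comment> \<open>Every index other than \<open>r\<close> is excluded by \<open>far\<close>, so
    the Dirichlet denominator \<open>k\<close> is \<open>r\<close>.\<close>
  then have close: "\<bar>real r * t - of_int h\<bar> \<le> 1 / real n"
    using far[of k h] by fastforce
  have "coprime h (int r)"
  proof (rule ccontr)
    assume "\<not> coprime h (int r)"
    \<comment> \<open>Dividing \<open>r\<close> and \<open>h\<close> by the common factor
      \<open>d\<close> gives a smaller index \<open>i\<close> with |i t - m| = |r t - h| / d \<le>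
      1/n, contradicting \<open>far\<close>.\<close>
    define d where "d = nat (gcd h (int r))"
    have "gcd h (int r) > 0" using r_pos by simp
    moreover have "gcd h (int r) \<noteq> 1"
      using \<open>\<not> coprime h (int r)\<close> by (simp add: coprime_iff_gcd_eq_1)
    ultimately have d: "2 \<le> d" unfolding d_def by linarith
    have "int d dvd h" "int d dvd int r" by (simp_all add: d_def)
    obtain m where m: "h = int d * m" using \<open>int d dvd h\<close> by (rule dvdE)
    obtain i where i: "r = d * i" using \<open>int d dvd int r\<close> by auto
    have "0 < i" using i r_pos by (intro Nat.gr0I) auto
    moreover have "i < r" using i d \<open>0 < i\<close> by simp
    ultimately have "1 / real n < \<bar>real i * t - of_int m\<bar>"
      using r_less_n by (intro far) auto
    also have "\<dots> \<le> real d * \<bar>real i * t - of_int m\<bar>"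
      using d by (intro mult_le_cancel_right1[THEN iffD2]) auto
    also have "\<dots> = \<bar>real r * t - of_int h\<bar>"
    proof -
      have "real r * t - of_int h = real d * (real i * t - of_int m)"
        by (simp add: i m algebra_simps)
      then show ?thesis by (simp add: abs_mult)
    qed
    finally show False using close by simp
  qed
  then have "h \<noteq> 0" "h \<noteq> int r" using r_ge2 by auto
  have "1 / real n < 1" using n_ge3 by simp
  moreover have "0 \<le> real r * t" "real r * t < real r" using t01 r0 by auto
  \<comment> \<open>The range of \<open>t\<close> leaves 0 \<le> \<open>h\<close> \<le>
    \<open>r\<close>; coprimality has already ruled out \<open>h = r\<close>.\<close>
  ultimately have "- 1 < real_of_int h" "real_of_int h < real r + 1"
    using close by linarith+
  then have "0 \<le> h" "h < int r" using \<open>h \<noteq> int r\<close> by linarith+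
  then have "h \<in> R" using \<open>coprime h (int r)\<close> by (simp add: coprime_residues_def)
  then obtain u where "inverse_pair h u" using inverse_pair_ex by blast
  moreover have "\<bar>real n * (real r * t - of_int h)\<bar> \<le> 1"
    using close n0 by (simp only: abs_mult abs_of_nat pos_le_divide_eq mult.commute[of "real n"])
  moreover have "t = near h (real n * (real r * t - of_int h))"
    using n0 r0 by (simp add: near_def field_simps)
  ultimately show thesis by (rule that)
qed

section \<open>Intervals in the coordinate around p/r\<close>

lemma near_0: "near p 0 = of_int p / real r"
  by (simp add: near_def)

lemma near_diff: "near p b - near p a = (b - a) / (real r * real n)"
  by (simp add: near_def diff_divide_distrib)

lemma near_less_iff: "near p a < near p b \<longleftrightarrow> a < b"
proof -
  have "0 < real r * real n" using r_pos n_ge3 by simp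
  then have "a / (real r * real n) < b / (real r * real n) \<longleftrightarrow> a < b"
    by (metis divide_less_cancel order_less_asym)
  then show ?thesis by (simp add: near_def)
qed

lemma near_coordinate:
  obtains y where "t = near p y"
proof
  show "t = near p ((t - of_int p / real r) * (real r * real n))"
    using r_pos n_ge3 by (simp add: near_def)
qed

lemma near_interval_in_components:
  assumes "inverse_pair p u" "a < b"
    and "\<And>y. a < y \<Longrightarrow> y < b \<Longrightarrow> near p y \<in> U_set n r"
    and "near p a \<notin> U_set n r" "near p b \<notin> U_set n r"
  shows "{near p a<..<near p b} \<in> components (U_set n r)"
proof (rule greaterThanLessThan_in_components)
  show "{near p a<..<near p b} \<subseteq> U_set n r"
  proof
    fix t assume t: "t \<in> {near p a<..<near p b}"
    obtain y where "t = near p y" by (rule near_coordinate)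
    then show "t \<in> U_set n r" using t assms(3) by (simp add: near_less_iff)
  qed
qed (use assms in \<open>auto simp: near_less_iff\<close>)

lemma measure_near_interval:
  assumes "a \<le> b"
  shows "measure lborel {near p a<..<near p b} = (b - a) / (real r * real n)"
proof -
  have "near p a \<le> near p b" using assms near_less_iff[of p b a] by linarith
  then show ?thesis by (simp add: near_diff)
qed

text \<open>Uniqueness holds because distinct fractions with denominator \<open>r\<close> are at
  least \<open>1 / r\<close> apart, whereas a common point of both neighbourhoods puts them within
  \<open>2 / (r n)\<close>, which is smaller as \<open>n\<close> is at least 3.\<close>

lemma near_interval_localized:
  assumes "- 1 \<le> a" "a < b" "b \<le> 1"
  shows "{near p a<..<near p b} \<subseteq> {t. \<bar>t - of_int p / real r\<bar> \<le> 1 / (real r * real n)}"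
    and "{near p a<..<near p b} \<subseteq> {t. \<bar>t - of_int q / real r\<bar> \<le> 1 / (real r * real n)}
      \<Longrightarrow> q = p"
proof -
  have n0: "real n > 0" and r0: "real r > 0" using n_ge3 r_pos by auto
  then have rn0: "0 < real r * real n" by simp
  have close: "\<bar>near p y - of_int p / real r\<bar> \<le> 1 / (real r * real n)" if "\<bar>y\<bar> \<le> 1" for y
  proof -
    have "\<bar>near p y - of_int p / real r\<bar> = \<bar>y\<bar> / (real r * real n)"
      using rn0 by (simp add: near_def abs_divide abs_mult)
    then show ?thesis using that rn0 by (metis divide_right_mono less_imp_le)
  qed
  show "{near p a<..<near p b} \<subseteq> {t. \<bar>t - of_int p / real r\<bar> \<le> 1 / (real r * real n)}"
  proof
    fix t assume t: "t \<in> {near p a<..<near p b}"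
    obtain y where y: "t = near p y" by (rule near_coordinate)
    then have "\<bar>y\<bar> \<le> 1" using t assms by (auto simp: near_less_iff)
    then show "t \<in> {t. \<bar>t - of_int p / real r\<bar> \<le> 1 / (real r * real n)}"
      using close y by simp
  qed
  assume sub: "{near p a<..<near p b} \<subseteq> {t. \<bar>t - of_int q / real r\<bar> \<le> 1 / (real r * real n)}"
  obtain y where y: "a < y" "y < b" using \<open>a < b\<close> dense by blast
  then have "near p y \<in> {near p a<..<near p b}" by (simp add: near_less_iff)
  then have "\<bar>near p y - of_int q / real r\<bar> \<le> 1 / (real r * real n)" using sub by blast
  moreover have "\<bar>near p y - of_int p / real r\<bar> \<le> 1 / (real r * real n)"
    using y assms by (intro close) auto
  ultimately have "\<bar>of_int q / real r - of_int p / real r\<bar> \<le> 2 * (1 / (real r * real n))"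
    by linarith
  then have "\<bar>of_int (q - p)\<bar> / real r \<le> (2 / real n) / real r"
    using r0 by (simp add: abs_divide mult.commute flip: diff_divide_distrib)
  then have "\<bar>real_of_int (q - p)\<bar> \<le> 2 / real n"
    using r0 by (meson divide_right_mono_neg divide_strict_right_mono not_le)
  also have "\<dots> < 1" using n_ge3 by simp
  finally show "q = p" by linarith
qed

lemma inverse_pairD:
  assumes "inverse_pair p u"
  shows "p \<in> R" "u \<in> R" "int r - u \<in> R" "coprime p (int r)"
  using assms coprime_residue_minus by (auto simp: inverse_pair_def coprime_residues_def)

section \<open>The components of U\<close>

text \<open>Without the condition |y| > 1/2, each \<open>p\<close> contributes one interval around
  \<open>y = 0\<close>; its endpoints are outside \<open>U_set n r\<close> because the defining
  inequalities are strict.\<close>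

lemma components_large:
  assumes large: "2 * r > n - 1"
  shows "components (U_set n r) =
    {{near p (- (real s / real (F u)))<..<near p (real s / real (F (int r - u)))} | p u.
       inverse_pair p u}" (is "_ = ?\<C>")
proof (rule components_eqI)
  show "?\<C> \<subseteq> components (U_set n r)"
  proof clarify
    fix p u assume pu: "inverse_pair p u"
    have b: "0 < real s / real (F u)" "real s / real (F u) \<le> 1"
      "0 < real s / real (F (int r - u))" "real s / real (F (int r - u)) \<le> 1"
      using s_div_F inverse_pairD[OF pu] by auto
    show "{near p (- (real s / real (F u)))<..<near p (real s / real (F (int r - u)))}
        \<in> components (U_set n r)"
      using b large near_mem_U_iff[OF pu] by (intro near_interval_in_components[OF pu]) auto
  qed
  show "U_set n r \<subseteq> \<Union>?\<C>"
  proof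
    fix t assume t: "t \<in> U_set n r"
    then obtain p u y where pu: "inverse_pair p u" and y: "\<bar>y\<bar> \<le> 1" "t = near p y"
      by (rule mem_U_imp_near)
    then have "t \<in> {near p (- (real s / real (F u)))<..<near p (real s / real (F (int r - u)))}"
      using t near_mem_U_iff[OF pu y(1)] by (simp add: near_less_iff)
    then show "t \<in> \<Union>?\<C>" using pu by blast
  qed
qed

text \<open>The condition |y| > 1/2 cuts the interval at each \<open>p\<close> into two halves, both
  nonempty by \<open>half_less_s_div_F\<close>.\<close>

lemma components_small:
  assumes small: "2 * r \<le> n - 1"
  shows "components (U_set n r) =
    {{near p (- (real s / real (F u)))<..<near p (- (1/2))} | p u. inverse_pair p u} \<union>
    {{near p (1/2)<..<near p (real s / real (F (int r - u)))} | p u. inverse_pair p u}"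
    (is "_ = ?\<A> \<union> ?\<B>")
proof (rule components_eqI)
  show "?\<A> \<union> ?\<B> \<subseteq> components (U_set n r)"
  proof -
    have "{near p (- (real s / real (F u)))<..<near p (- (1/2))} \<in> components (U_set n r) \<and>
        {near p (1/2)<..<near p (real s / real (F (int r - u)))} \<in> components (U_set n r)"
      if pu: "inverse_pair p u" for p u
    proof -
      have b: "1/2 < real s / real (F u)" "real s / real (F u) \<le> 1"
        "1/2 < real s / real (F (int r - u))" "real s / real (F (int r - u)) \<le> 1"
        using s_div_F half_less_s_div_F[OF small] inverse_pairD[OF pu] by auto
      show ?thesis
        using b small near_mem_U_iff[OF pu]
        by (intro conjI near_interval_in_components[OF pu])
          (auto simp del: divide_less_eq_numeral1 less_divide_eq_numeral1)
    qed
    then show ?thesis by blast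
  qed
  show "U_set n r \<subseteq> \<Union>(?\<A> \<union> ?\<B>)"
  proof
    fix t assume t: "t \<in> U_set n r"
    then obtain p u y where pu: "inverse_pair p u" and y: "\<bar>y\<bar> \<le> 1" "t = near p y"
      by (rule mem_U_imp_near)
    then have "t \<in> {near p (- (real s / real (F u)))<..<near p (- (1/2))} \<or>
        t \<in> {near p (1/2)<..<near p (real s / real (F (int r - u)))}"
      using t small near_mem_U_iff[OF pu y(1)] by (auto simp: near_less_iff)
    then show "t \<in> \<Union>(?\<A> \<union> ?\<B>)" using pu by blast
  qed
qed

lemma component_near_fraction:
  assumes "C \<in> components (U_set n r)"
  shows "\<exists>p :: int.
            coprime p (int r) \<and>
            C \<subseteq> {t. \<bar>t - of_int p / real r\<bar> \<le> 1 / (real r * real n)} \<and>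
            (\<forall>q :: int. coprime q (int r) \<and>
               C \<subseteq> {t. \<bar>t - of_int q / real r\<bar> \<le> 1 / (real r * real n)} \<longrightarrow> q = p) \<and>
            (2 * r > n - 1 \<longrightarrow> of_int p / real r \<in> C) \<and>
            (2 * r \<le> n - 1 \<longrightarrow> of_int p / real r \<notin> C \<and> of_int p / real r \<notin> U_set n r)"
proof (cases "2 * r \<le> n - 1")
  case True
  obtain p u a b where pu: "inverse_pair p u" and C: "C = {near p a<..<near p b}"
    and ab: "a = - (real s / real (F u)) \<and> b = - (1/2) \<or>
      a = 1/2 \<and> b = real s / real (F (int r - u))"
    using assms unfolding components_small[OF True] by blast
  have "- 1 \<le> a" "a < b" "b \<le> 1"
    using ab s_div_F[of u] s_div_F[of "int r - u"] inverse_pairD[OF pu]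
      half_less_s_div_F[OF True, of u] half_less_s_div_F[OF True, of "int r - u"]
    by (auto simp del: divide_less_eq_numeral1 less_divide_eq_numeral1)
  note loc = near_interval_localized[OF this, of p]
  \<comment> \<open>At \<open>p / r\<close> the coordinate is 0, which violates |y| > 1/2.\<close>
  have "of_int p / real r \<notin> U_set n r"
    using near_mem_U_iff[OF pu, of 0] True by (simp add: near_0)
  moreover have "C \<subseteq> U_set n r" using assms by (rule in_components_subset)
  ultimately show ?thesis
    using loc inverse_pairD(4)[OF pu] True unfolding C by (intro exI[of _ p]) auto
next
  case False
  then have large: "2 * r > n - 1" by simp
  obtain p u where pu: "inverse_pair p u"
    and C: "C = {near p (- (real s / real (F u)))<..<near p (real s / real (F (int r - u)))}"
    using assms unfolding components_large[OF large] by blast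
  have b: "0 < real s / real (F u)" "real s / real (F u) \<le> 1"
      "0 < real s / real (F (int r - u))" "real s / real (F (int r - u)) \<le> 1"
    using s_div_F inverse_pairD[OF pu] by auto
  then have "near p 0 \<in> C" unfolding C by (auto simp: near_less_iff)
  then have "of_int p / real r \<in> C" by (simp add: near_0)
  moreover have "- 1 \<le> - (real s / real (F u))"
    "- (real s / real (F u)) < real s / real (F (int r - u))"
    using b by linarith+
  note loc = near_interval_localized[OF this b(4), of p]
  ultimately show ?thesis
    using loc inverse_pairD(4)[OF pu] large unfolding C by (intro exI[of _ p]) auto
qed

section \<open>Lengths of the longest components\<close>

text \<open>Every \<open>u\<close> in \<open>R\<close> is the inverse of some \<open>p\<close>, so
  the component lengths are exactly the values over \<open>R\<close>, and the maximum is
  attained.\<close>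

lemma longest_component_large:
  assumes large: "2 * r > n - 1"
  shows "longest_component_length (U_set n r) (real s / (real r * real n) *
    Max ((\<lambda>u. 1 / real (F u) + 1 / real (F (int r - u))) ` R))"
proof -
  let ?g = "\<lambda>u. 1 / real (F u) + 1 / real (F (int r - u))"
  have len: "measure lborel {near p (- (real s / real (F u)))<..<near p (real s / real (F (int r - u)))}
      = real s / (real r * real n) * ?g u" if "inverse_pair p u" for p u
  proof -
    have "0 < real s / real (F u)" "0 < real s / real (F (int r - u))"
      using s_div_F inverse_pairD[OF that] by auto
    then have "measure lborel {near p (- (real s / real (F u)))<..<near p (real s / real (F (int r - u)))}
      = (real s / real (F (int r - u)) - - (real s / real (F u))) / (real r * real n)"
      by (intro measure_near_interval) linarith
    then show ?thesis by (simp add: algebra_simps add_divide_distrib)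
  qed
  have "Max (?g ` R) \<in> ?g ` R"
    using finite_coprime_residues coprime_residues_nonempty by (intro Max_in) auto
  then obtain u where u: "u \<in> R" "Max (?g ` R) = ?g u" by blast
  obtain p where pu: "inverse_pair p u" using inverse_pair_ex[OF u(1)] by blast
  show ?thesis
    unfolding longest_component_length_def
  proof (intro bexI conjI ballI)
    show "{near p (- (real s / real (F u)))<..<near p (real s / real (F (int r - u)))}
        \<in> components (U_set n r)"
      unfolding components_large[OF large] using pu by blast
    show "measure lborel {near p (- (real s / real (F u)))<..<near p (real s / real (F (int r - u)))}
      = real s / (real r * real n) * Max (?g ` R)"
      using len[OF pu] u(2) by simp
    fix C assume "C \<in> components (U_set n r)"
    then obtain p' u' where pu': "inverse_pair p' u'"
      and C: "C = {near p' (- (real s / real (F u')))<..<near p' (real s / real (F (int r - u')))}"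
      unfolding components_large[OF large] by blast
    have "?g u' \<le> Max (?g ` R)"
      using finite_coprime_residues inverse_pairD(2)[OF pu'] by (intro Max_ge) auto
    then show "measure lborel C \<le> real s / (real r * real n) * Max (?g ` R)"
      unfolding C len[OF pu'] by (intro mult_left_mono) auto
  qed
qed

lemma I_min_le:
  assumes "u \<in> R"
  shows "I_min n r \<le> F u"
proof -
  have "I_min n r \<le> min (F u) (F (int r - u))"
    unfolding I_min_def
    by (rule Min_le[OF finite_imageI[OF finite_coprime_residues] image_eqI[OF refl assms]])
  then show ?thesis by simp
qed

text \<open>The symmetry exchanging \<open>u\<close> and \<open>r - u\<close> allows the minimum to
  be placed at a right endpoint.\<close>

lemma I_min_attained:
  obtains u where "u \<in> R" "F (int r - u) = I_min n r"
proof -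
  have "I_min n r \<in> (\<lambda>u. min (F u) (F (int r - u))) ` R"
    unfolding I_min_def
    using finite_coprime_residues coprime_residues_nonempty by (intro Min_in) auto
  then obtain u where u: "u \<in> R" "I_min n r = min (F u) (F (int r - u))" by blast
  show thesis
  proof (cases "F u \<le> F (int r - u)")
    case True
    then show thesis using u by (intro that[OF coprime_residue_minus[OF u(1)]]) simp
  next
    case False
    then show thesis using u by (intro that[OF u(1)]) simp
  qed
qed

lemma I_min_pos: "0 < I_min n r"
proof -
  obtain u where u: "u \<in> R" "F (int r - u) = I_min n r" by (rule I_min_attained)
  then show ?thesis using F_pos[OF coprime_residue_minus[OF u(1)]] by simp
qed

lemma s_div_F_le:
  assumes "u \<in> R"
  shows "real s / real (F u) \<le> real s / real (I_min n r)"
  using I_min_le[OF assms] I_min_pos by (intro divide_left_mono) auto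

text \<open>A half has coordinate length \<open>s / F - 1/2\<close>, largest where \<open>F\<close>
  takes its minimum \<open>I_min n r\<close>; the inequality \<open>I_min n r < 2 * s\<close> says
  that this length is positive.\<close>

lemma longest_component_small:
  assumes small: "2 * r \<le> n - 1"
  shows "I_min n r < 2 * s" and "longest_component_length (U_set n r)
    ((2 * real s - real (I_min n r)) / (2 * real r * real n * real (I_min n r)))"
proof -
  let ?L = "(2 * real s - real (I_min n r)) / (2 * real r * real n * real (I_min n r))"
  obtain u where u: "u \<in> R" "F (int r - u) = I_min n r" by (rule I_min_attained)
  obtain p where pu: "inverse_pair p u" using inverse_pair_ex[OF u(1)] by blast
  have I0: "0 < real (I_min n r)" using I_min_pos by simp
  have half: "1/2 < real s / real (I_min n r)"
    using half_less_s_div_F[OF small coprime_residue_minus[OF u(1)]] u(2) by simp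
  then have "real (I_min n r) < real (2 * s)" using I0 by (simp add: field_simps)
  then show "I_min n r < 2 * s" by linarith
  have L: "?L = (real s / real (I_min n r) - 1/2) / (real r * real n)"
    using I0 r_pos n_ge3 by (simp add: field_simps)
  show "longest_component_length (U_set n r) ?L"
    unfolding longest_component_length_def
  proof (intro bexI conjI ballI)
    show "{near p (1/2)<..<near p (real s / real (F (int r - u)))} \<in> components (U_set n r)"
      unfolding components_small[OF small] using pu by blast
    show "measure lborel {near p (1/2)<..<near p (real s / real (F (int r - u)))} = ?L"
      unfolding L u(2) using half by (intro measure_near_interval) simp
    fix C assume "C \<in> components (U_set n r)"
    then obtain p' u' a b where pu': "inverse_pair p' u'" and C: "C = {near p' a<..<near p' b}"
      and ab: "a = - (real s / real (F u')) \<and> b = - (1/2) \<or>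
        a = 1/2 \<and> b = real s / real (F (int r - u'))"
      unfolding components_small[OF small] by blast
    note R = inverse_pairD(2,3)[OF pu']
    have "a \<le> b"
      using ab half_less_s_div_F[OF small R(1)] half_less_s_div_F[OF small R(2)]
      by linarith
    moreover have "b - a \<le> real s / real (I_min n r) - 1/2"
      using ab s_div_F_le[OF R(1)] s_div_F_le[OF R(2)] by auto
    ultimately show "measure lborel C \<le> ?L"
      unfolding C L by (simp add: measure_near_interval divide_right_mono)
  qed
qed

section \<open>The supremum of the distance from rt to the integers\<close>

lemma dist_int_near:
  assumes "\<bar>y\<bar> \<le> 1"
  shows "dist_int (real r * near p y) = \<bar>y\<bar> / real n"
proof -
  have "real r * near p y = of_int p + y / real n"
    using r_pos by (simp add: near_def field_simps)
  moreover have "\<bar>y / real n\<bar> \<le> 1/2"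
    using assms n_ge3 by (simp add: abs_divide field_simps)
  ultimately show ?thesis by (simp add: dist_int_of_int_add abs_divide)
qed

text \<open>The distance is |y| / n, and |y| stays strictly below \<open>s / I_min n r\<close>. The
  supremum is approached, not attained, at the right endpoint of a component with
  \<open>F (r - u) = I_min n r\<close>.\<close>

lemma SUP_dist_int_large:
  assumes large: "2 * r > n - 1"
  shows "(SUP t \<in> U_set n r. dist_int (real r * t)) = real s / (real n * real (I_min n r))"
    (is "Sup ?X = _")
proof -
  have n0: "real n > 0" using n_ge3 by simp
  obtain u where u: "u \<in> R" "F (int r - u) = I_min n r" by (rule I_min_attained)
  obtain p where pu: "inverse_pair p u" using inverse_pair_ex[OF u(1)] by blast
  have b: "0 < real s / real (I_min n r)" "real s / real (I_min n r) \<le> 1"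
    using s_div_F[OF coprime_residue_minus[OF u(1)]] unfolding u(2) by blast+
  \<comment> \<open>Nonnegative coordinates meet the lower bound \<open>- s / F u\<close>
    automatically, so only the right endpoint restricts \<open>y\<close>.\<close>
  have in_X: "y / real n \<in> ?X" if y: "0 \<le> y" "y < real s / real (I_min n r)" for y
  proof -
    have "\<bar>y\<bar> \<le> 1" using y b by linarith
    moreover have "near p y \<in> U_set n r"
      using near_mem_U_iff[OF pu \<open>\<bar>y\<bar> \<le> 1\<close>] y large s_div_F[OF u(1)] u(2) by auto
    ultimately show ?thesis using dist_int_near[of y p] y by (intro image_eqI) auto
  qed
  have "Sup ?X = real s / real (I_min n r) / real n"
  proof (rule cSup_eq_non_empty)
    show "?X \<noteq> {}" using in_X[of 0] b by blast
  next
    fix x assume "x \<in> ?X"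
    then obtain t where t: "t \<in> U_set n r" "x = dist_int (real r * t)" by blast
    obtain p' u' y where pu': "inverse_pair p' u'" and y: "\<bar>y\<bar> \<le> 1" "t = near p' y"
      using t(1) by (rule mem_U_imp_near)
    have "\<bar>y\<bar> \<le> real s / real (I_min n r)"
      using t(1) near_mem_U_iff[OF pu' y(1)] y(2)
        s_div_F_le[OF inverse_pairD(2)[OF pu']] s_div_F_le[OF inverse_pairD(3)[OF pu']] by auto
    then show "x \<le> real s / real (I_min n r) / real n"
      using dist_int_near[OF y(1)] t(2) y(2) by (simp only: divide_right_mono of_nat_0_le_iff)
  next
    fix z assume z: "\<And>x. x \<in> ?X \<Longrightarrow> x \<le> z"
    have "real s / real (I_min n r) \<le> z * real n"
    proof (rule dense_le_bounded[OF b(1)])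
      fix y assume "0 < y" "y < real s / real (I_min n r)"
      then have "y / real n \<le> z" by (intro z in_X) auto
      then show "y \<le> z * real n" using n0 by (simp add: pos_divide_le_eq)
    qed
    then show "real s / real (I_min n r) / real n \<le> z" using n0 by (simp only: pos_divide_le_eq)
  qed
  then show ?thesis by (simp add: mult.commute)
qed

end

theorem theorem1p4:
  fixes n r s :: nat
  assumes "2 \<le> r" and "r \<le> n - 1" and "s = n - r"
  shows "(\<forall>C \<in> components (U_set n r). \<exists>p :: int.
            coprime p (int r) \<and>
            C \<subseteq> {t. \<bar>t - of_int p / real r\<bar> \<le> 1 / (real r * real n)} \<and>
            (\<forall>q :: int. coprime q (int r) \<and>
               C \<subseteq> {t. \<bar>t - of_int q / real r\<bar> \<le> 1 / (real r * real n)} \<longrightarrow> q = p) \<and>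
            (2 * r > n - 1 \<longrightarrow> of_int p / real r \<in> C) \<and>
            (2 * r \<le> n - 1 \<longrightarrow> of_int p / real r \<notin> C \<and> of_int p / real r \<notin> U_set n r))
       \<and> (2 * r > n - 1 \<longrightarrow>
            longest_component_length (U_set n r)
              (real s / (real r * real n) *
               Max ((\<lambda>u. 1 / real (F_max n r u) + 1 / real (F_max n r (int r - u)))
                    ` coprime_residues r)))
       \<and> (2 * r \<le> n - 1 \<longrightarrow>
            2 * s > I_min n r \<and>
            longest_component_length (U_set n r)
              ((2 * real s - real (I_min n r)) / (2 * real r * real n * real (I_min n r))))
       \<and> (2 * r > n - 1 \<longrightarrow>
            (SUP t \<in> U_set n r. dist_int (real r * t)) = real s / (real n * real (I_min n r)))"
proof -
  interpret punctured_distance n r s using assms by unfold_locales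
  show ?thesis
    by (intro conjI ballI impI component_near_fraction longest_component_large
        longest_component_small SUP_dist_int_large)
qed

end
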